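(* Let $\mathcal M=\{m_1,\dots,m_N\}$ be a set of $N$ men and $\mathcal W=\{w_1,\dots,w_N\}$ a set of $N$ women, and let $P:\mathcal M\times\mathcal W\to\mathbb R_{>0}$ be any function. If the preference profile is sampled from the symmetric anti-popularity preference distribution defined by $P$, then the output distributions of the men-proposing deferred acceptance procedure (MPDA) and the women-proposing deferred acceptance procedure (WPDA) are identical; that is, for every perfect matching $\mu$ between $\mathcal M$ and $\mathcal W$, $$\mathbb P[\text{MPDA outputs }\mu]=\mathbb P[\text{WPDA outputs }\mu].$$
   Context: A preference profile gives each man $m$ a strict total order $\succ_m$ over $\mathcal W$ and each woman $w$ a strict total order $\succ_w$ over $\mathcal M$. Symmetric anti-popularity preference distribution defined by $P$: the preference lists of all $2N$ agents are mutually independent. Each man $m$ builds his list from the end, by sampling without replacement from the distribution on $\mathcal W$ that gives woman $w$ probability proportional to $1/P(m,w)$: he first samples his least preferred woman, then his second least preferred, and so on up to his favourite (at each step a woman $w$ not yet sampled is chosen with probability $1/P(m,w)$ divided by the sum of $1/P(m,w')$ over the women $w'$ not yet sampled). Symmetrically, each woman $w$ builds her list from the end, by sampling without replacement from the distribution on $\mathcal M$ that gives man $m$ probability proportional to $1/P(m,w)$. A (perfect) matching is an involution $\mu$ of $\mathcal M\cup\mathcal W$ with $\mu(\mathcal M)\subseteq\mathcal W$ and $\mu(\mathcal W)\subseteq\mathcal M$. It is stable if for all $m\in\mathcal M$, $w\in\mathcal W$, $\mu(m)\succeq_m w$ or $\mu(w)\succeq_w m$. MPDA is the Gale--Shapley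 deferred acceptance algorithm in which men propose. Its output is the men-optimal stable matching, i.e. the unique stable matching that every man weakly prefers to every other stable matching. WPDA is the same algorithm with women proposing. Its output is the women-optimal stable matching, i.e. the unique stable matching that every woman weakly prefers to every other stable matching. *)

theory Defs
  imports "HOL-Probability.Probability" "HOL-Library.While_Combinator"
begin

text \<open>Preference lists are written from most to least preferred.\<close>

definition prefers :: "'a list \<Rightarrow> 'a \<Rightarrow> 'a \<Rightarrow> bool" where
  "prefers l x y \<longleftrightarrow> (\<exists>i j. i < j \<and> j < length l \<and> l ! i = x \<and> l ! j = y)"

definition weighted_pmf :: "('a \<Rightarrow> real) \<Rightarrow> 'a set \<Rightarrow> 'a pmf" where
  "weighted_pmf f A = embed_pmf (\<lambda>x. if x \<in> A then f x / (\<Sum>y\<in>A. f y) else 0)"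

text \<open>The term \<open>embed_pmf\<close> is meaningful only for a genuine probability mass function, which
  is the case in all uses below.\<close>

lemma pmf_weighted_pmf:
  assumes "finite A" "A \<noteq> {}" "\<And>y. y \<in> A \<Longrightarrow> f y > 0"
  shows "pmf (weighted_pmf f A) x = (if x \<in> A then f x / (\<Sum>y\<in>A. f y) else 0)"
  unfolding weighted_pmf_def
proof (rule pmf_embed_pmf)
  have pos: "(\<Sum>y\<in>A. f y) > 0"
    using assms by (intro sum_pos) auto
  show "0 \<le> (if x \<in> A then f x / (\<Sum>y\<in>A. f y) else 0)" for x
    using assms(3)[of x] pos by auto
  have "(\<integral>\<^sup>+x. ennreal (if x \<in> A then f x / (\<Sum>y\<in>A. f y) else 0) \<partial>count_space UNIV)
      = (\<Sum>x\<in>A. ennreal (f x / (\<Sum>y\<in>A. f y)))"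
    using assms(1) by (subst nn_integral_count_space'[of A]) auto
  also have "\<dots> = ennreal (\<Sum>x\<in>A. f x / (\<Sum>y\<in>A. f y))"
    using assms(3) pos by (intro sum_ennreal) (auto intro!: divide_nonneg_pos less_imp_le)
  also have "(\<Sum>x\<in>A. f x / (\<Sum>y\<in>A. f y)) = 1"
    using pos by (simp flip: sum_divide_distrib)
  finally show "(\<integral>\<^sup>+x. ennreal (if x \<in> A then f x / (\<Sum>y\<in>A. f y) else 0) \<partial>count_space UNIV) = 1"
    by simp
qed

text \<open>The first \<open>n\<close> draws without replacement from \<open>A\<close>, in the order in which they are drawn.\<close>

primrec sample_without_replacement :: "nat \<Rightarrow> ('a \<Rightarrow> real) \<Rightarrow> 'a set \<Rightarrow> 'a list pmf" where
  "sample_without_replacement 0 f A = return_pmf []"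
| "sample_without_replacement (Suc n) f A =
     bind_pmf (weighted_pmf f A) (\<lambda>x.
       map_pmf (\<lambda>xs. x # xs) (sample_without_replacement n f (A - {x})))"

text \<open>The list is built from the end: the element drawn first is the least preferred one.\<close>

definition anti_popularity_list :: "('a::finite \<Rightarrow> real) \<Rightarrow> 'a list pmf" where
  "anti_popularity_list p =
     map_pmf rev (sample_without_replacement CARD('a) (\<lambda>x. 1 / p x) UNIV)"

text \<open>As the index sets are all of \<open>UNIV\<close>, the default value \<open>[]\<close> passed to \<open>Pi_pmf\<close> plays no role.\<close>

definition anti_popularity_profile ::
    "('m::finite \<Rightarrow> 'w::finite \<Rightarrow> real) \<Rightarrow> (('m \<Rightarrow> 'w list) \<times> ('w \<Rightarrow> 'm list)) pmf" where
  "anti_popularity_profile P =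
     pair_pmf (Pi_pmf UNIV [] (\<lambda>m. anti_popularity_list (\<lambda>w. P m w)))
              (Pi_pmf UNIV [] (\<lambda>w. anti_popularity_list (\<lambda>m. P m w)))"

definition perfect_matching :: "('m + 'w \<Rightarrow> 'm + 'w) \<Rightarrow> bool" where
  "perfect_matching \<mu> \<longleftrightarrow>
     (\<forall>x. \<mu> (\<mu> x) = x) \<and> \<mu> ` range Inl \<subseteq> range Inr \<and> \<mu> ` range Inr \<subseteq> range Inl"

text \<open>
  Deferred acceptance with proposers \<open>'a\<close> and receivers \<open>'b\<close>, in rounds as in Gale and Shapley's
  original description. The state \<open>R\<close> is the set of pairs \<open>(a, b)\<close> such that \<open>b\<close> has rejected \<open>a\<close>.
  In each round every proposer is at his favourite receiver among those who have not rejected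
  him (his proposal there is either new or on hold), and every receiver rejects all her current
  suitors except the one she prefers most. The procedure stops when there are no new rejections.
\<close>

definition proposal :: "('a \<Rightarrow> 'b list) \<Rightarrow> ('a \<times> 'b) set \<Rightarrow> 'a \<Rightarrow> 'b option" where
  "proposal pa R a = find (\<lambda>b. (a, b) \<notin> R) (pa a)"

definition da_round ::
    "('a \<Rightarrow> 'b list) \<Rightarrow> ('b \<Rightarrow> 'a list) \<Rightarrow> ('a \<times> 'b) set \<Rightarrow> ('a \<times> 'b) set" where
  "da_round pa pb R = R \<union> {(a, b). proposal pa R a = Some b \<and>
     (\<exists>a'. proposal pa R a' = Some b \<and> prefers (pb b) a' a)}"

definition deferred_acceptance ::
    "('a \<Rightarrow> 'b list) \<Rightarrow> ('b \<Rightarrow> 'a list) \<Rightarrow> ('a \<times> 'b) set" where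
  "deferred_acceptance pa pb =
     (let R = while (\<lambda>R. da_round pa pb R \<noteq> R) (da_round pa pb) {}
      in {(a, b). proposal pa R a = Some b})"

definition matching_of_pairs :: "('m \<times> 'w) set \<Rightarrow> 'm + 'w \<Rightarrow> 'm + 'w" where
  "matching_of_pairs E x =
     (case x of Inl m \<Rightarrow> Inr (THE w. (m, w) \<in> E) | Inr w \<Rightarrow> Inl (THE m. (m, w) \<in> E))"

definition MPDA :: "('m \<Rightarrow> 'w list) \<times> ('w \<Rightarrow> 'm list) \<Rightarrow> 'm + 'w \<Rightarrow> 'm + 'w" where
  "MPDA = (\<lambda>(men, women). matching_of_pairs (deferred_acceptance men women))"

definition WPDA :: "('m \<Rightarrow> 'w list) \<times> ('w \<Rightarrow> 'm list) \<Rightarrow> 'm + 'w \<Rightarrow> 'm + 'w" where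
  "WPDA = (\<lambda>(men, women). matching_of_pairs ((deferred_acceptance women men)\<inverse>))"

end

theory Submission
  imports Defs "HOL-Library.Sublist"
begin

text \<open>
  A stable matching is optimal for the proposers iff no cycle arises when each receiver points to
  the partner of the best proposer, worse than her own partner, who would leave his partner for
  her. Inclusion-exclusion over sets of disjoint cycles, in the form of the determinant
  \<open>det (1 - A)\<close> of the pointing graph, writes the probability that a matching \<open>\<mu>\<close> is the outcome as
  a signed sum over permutations \<open>\<sigma>\<close>. Each summand is the probability that the agents on the cycles
  rank two given options in a prescribed order and that no other pair ranks each other above the
  worse of their two options. For the other proposing side, the summand of \<open>inv \<sigma>\<close> is the same event
  with all these orders reversed. As lists are drawn from the bottom, given the draws before the
  first of two options, the probabilities that one or the other comes next are proportional to
  their weights. Reversing all orders multiplies the probability by a quotient of products of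
  weights, and over whole cycles the factors contributed by the men and by the women cancel.
\<close>

section \<open>Deferred acceptance and closed sets of suitors\<close>

definition complete_list :: "'a list \<Rightarrow> bool" where
  "complete_list l \<longleftrightarrow> distinct l \<and> set l = UNIV"

text \<open>Positions in the list give an injective rank, so that irreflexivity, transitivity and
  totality of \<open>prefers\<close> are inherited from \<open><\<close> on the naturals.\<close>

lemma complete_list_rank:
  assumes "complete_list l"
  obtains r :: "'a \<Rightarrow> nat" where "inj r" "\<And>x. r x < length l" "\<And>x. l ! r x = x"
    "\<And>i. i < length l \<Longrightarrow> r (l ! i) = i" "\<And>x y. prefers l x y \<longleftrightarrow> r x < r y"
proof -
  have "\<forall>x. \<exists>i. i < length l \<and> l ! i = x"
    using assms unfolding complete_list_def by (metis UNIV_I in_set_conv_nth)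
  then obtain r where r: "\<And>x. r x < length l" "\<And>x. l ! r x = x" by metis
  have r': "r (l ! i) = i" if "i < length l" for i
    using nth_eq_iff_index_eq[of l "r (l ! i)" i] that r assms unfolding complete_list_def by blast
  have "inj r" by (metis injI r(2))
  moreover have "prefers l x y \<longleftrightarrow> r x < r y" for x y
    unfolding prefers_def using r r' by (metis order.strict_trans)
  ultimately show ?thesis using that r r' by blast
qed

lemma prefers_irrefl: "complete_list l \<Longrightarrow> \<not> prefers l x x"
  by (metis complete_list_rank less_irrefl)

lemma prefers_trans: "complete_list l \<Longrightarrow> prefers l x y \<Longrightarrow> prefers l y z \<Longrightarrow> prefers l x z"
  by (metis complete_list_rank less_trans)

lemma prefers_total: "complete_list l \<Longrightarrow> x \<noteq> y \<Longrightarrow> prefers l x y \<or> prefers l y x"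
  by (metis complete_list_rank injD linorder_neqE_nat)

lemma prefers_asym: "complete_list l \<Longrightarrow> prefers l x y \<Longrightarrow> \<not> prefers l y x"
  by (metis complete_list_rank less_asym)

lemma prefers_best:
  assumes "complete_list l" "A \<noteq> {}"
  shows "\<exists>x\<in>A. \<forall>y\<in>A. \<not> prefers l y x"
proof -
  from assms(1) obtain r where r: "\<And>x y. prefers l x y \<longleftrightarrow> r x < (r y :: nat)"
    by (rule complete_list_rank) (rule that)
  from assms(2) obtain a where "a \<in> A" by blast
  then obtain x where "x \<in> A" "\<And>y. y \<in> A \<Longrightarrow> r x \<le> r y"
    using ex_has_least_nat[of "\<lambda>x. x \<in> A" a r] by blast
  then show ?thesis by (auto simp: r not_less)
qed

lemma proposal_Some_iff:
  assumes "complete_list (pa a)"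
  shows "proposal pa R a = Some b \<longleftrightarrow> (a, b) \<notin> R \<and> (\<forall>b'. prefers (pa a) b' b \<longrightarrow> (a, b') \<in> R)"
proof -
  obtain r where r: "\<And>x. r x < length (pa a)" "\<And>x. pa a ! r x = x"
    "\<And>i. i < length (pa a) \<Longrightarrow> r (pa a ! i) = i" "\<And>x y. prefers (pa a) x y \<longleftrightarrow> r x < r y"
    by (rule complete_list_rank[OF assms]) (rule that)
  show ?thesis
  proof
    assume "proposal pa R a = Some b"
    then obtain i where "i < length (pa a)" "(a, pa a ! i) \<notin> R" "b = pa a ! i"
      "\<And>j. j < i \<Longrightarrow> (a, pa a ! j) \<in> R"
      unfolding proposal_def find_Some_iff by blast
    then show "(a, b) \<notin> R \<and> (\<forall>b'. prefers (pa a) b' b \<longrightarrow> (a, b') \<in> R)"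
      using r(3)[of i] r(2) unfolding r(4) by metis
  next
    assume R: "(a, b) \<notin> R \<and> (\<forall>b'. prefers (pa a) b' b \<longrightarrow> (a, b') \<in> R)"
    have "(a, pa a ! j) \<in> R" if "j < r b" for j
      using R that r(1)[of b] r(3)[of j] unfolding r(4) by simp
    then show "proposal pa R a = Some b"
      unfolding proposal_def find_Some_iff using R r(1)[of b] r(2)[of b] by (intro exI[of _ "r b"]) simp
  qed
qed

lemma proposal_None_iff:
  assumes "complete_list (pa a)"
  shows "proposal pa R a = None \<longleftrightarrow> (\<forall>b. (a, b) \<in> R)"
  using assms unfolding proposal_def find_None_iff complete_list_def by auto

section \<open>Rounds of deferred acceptance, with either side in the role of proposers\<close>

locale deferred_acceptance_market =
  fixes pa :: "'a::finite \<Rightarrow> 'b::finite list" and pb :: "'b \<Rightarrow> 'a list"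
  assumes complete_pa: "\<And>a. complete_list (pa a)"
    and complete_pb: "\<And>b. complete_list (pb b)"
    and card_eq: "CARD('a) = CARD('b)"
begin

definition rejected :: "nat \<Rightarrow> ('a \<times> 'b) set" where
  "rejected n = (da_round pa pb ^^ n) {}"

lemma rejected_0: "rejected 0 = {}"
  and rejected_Suc: "rejected (Suc n) = da_round pa pb (rejected n)"
  by (simp_all add: rejected_def)

lemma rejected_mono: "m \<le> n \<Longrightarrow> rejected m \<subseteq> rejected n"
  by (rule lift_Suc_mono_le[of rejected]) (auto simp: rejected_Suc da_round_def)

abbreviation proposes :: "nat \<Rightarrow> 'a \<Rightarrow> 'b \<Rightarrow> bool" where
  "proposes n a b \<equiv> proposal pa (rejected n) a = Some b"

lemma proposes_iff:
  "proposes n a b \<longleftrightarrow> (a, b) \<notin> rejected n \<and> (\<forall>b'. prefers (pa a) b' b \<longrightarrow> (a, b') \<in> rejected n)"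
  by (rule proposal_Some_iff) (rule complete_pa)

lemma rejected_Suc_iff:
  "(a, b) \<in> rejected (Suc n) \<longleftrightarrow> (a, b) \<in> rejected n \<or>
     proposes n a b \<and> (\<exists>a'. proposes n a' b \<and> prefers (pb b) a' a)"
  by (auto simp: rejected_Suc da_round_def)

lemma rejected_by_earlier_proposal:
  "(a, b) \<in> rejected n \<Longrightarrow> \<exists>m<n. \<exists>a'. proposes m a' b \<and> prefers (pb b) a' a"
proof (induction n)
  case (Suc n)
  then show ?case unfolding rejected_Suc_iff by (meson less_Suc_eq)
qed (simp add: rejected_0)

lemma rejected_downward:
  "(a, b) \<in> rejected n \<Longrightarrow> prefers (pa a) b' b \<Longrightarrow> (a, b') \<in> rejected n"
proof (induction n)
  case (Suc n)
  then show ?case unfolding rejected_Suc_iff proposes_iff by blast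
qed (simp add: rejected_0)

lemma proposes_Suc: "proposes n a b \<Longrightarrow> (a, b) \<notin> rejected (Suc n) \<Longrightarrow> proposes (Suc n) a b"
  using rejected_mono[of n "Suc n"] unfolding proposes_iff by auto

lemma best_suitor_kept:
  assumes "proposes n a b"
  shows "\<exists>a'. proposes (Suc n) a' b \<and> (a' = a \<or> prefers (pb b) a' a)"
proof -
  have "{a. proposes n a b} \<noteq> {}" using assms by blast
  from prefers_best[OF complete_pb[of b] this] obtain a' where
    a': "proposes n a' b" "\<And>y. proposes n y b \<Longrightarrow> \<not> prefers (pb b) y a'" by blast
  then have "(a', b) \<notin> rejected (Suc n)"
    unfolding rejected_Suc_iff by (auto simp: proposes_iff)
  with a'(1) have "proposes (Suc n) a' b" by (rule proposes_Suc)
  moreover have "a' = a \<or> prefers (pb b) a' a"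
    using a'(2)[OF assms] prefers_total[OF complete_pb[of b], of a' a] by blast
  ultimately show ?thesis by blast
qed

text \<open>By \<open>best_suitor_kept\<close> the best suitor at a receiver never gets worse, so
  the reason for a rejection persists through all later rounds.\<close>

lemma rejected_better_suitor:
  "(a, b) \<in> rejected n \<Longrightarrow> \<exists>a'. proposes n a' b \<and> prefers (pb b) a' a"
proof (induction n)
  case (Suc n)
  then obtain a' where a': "proposes n a' b" "prefers (pb b) a' a"
    unfolding rejected_Suc_iff by blast
  from best_suitor_kept[OF a'(1)] obtain a'' where
    "proposes (Suc n) a'' b" "a'' = a' \<or> prefers (pb b) a'' a'" by blast
  then show ?case using a'(2) prefers_trans[OF complete_pb[of b], of a'' a' a] by blast
qed (simp add: rejected_0)

lemma deferred_acceptance_terminates: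
  obtains n where "rejected (Suc n) = rejected n"
    "deferred_acceptance pa pb = {(a, b). proposes n a b}"
proof -
  let ?w = "while (\<lambda>R. da_round pa pb R \<noteq> R) (da_round pa pb) {}"
  have "\<exists>n. ?w = rejected n \<and> rejected (Suc n) = rejected n"
  \<comment> \<open>The number of pairs not yet rejected decreases in every round that changes the
    state.\<close>
  proof (rule while_rule[where P = "\<lambda>R. \<exists>n. R = rejected n" and r = "Wellfounded.measure (\<lambda>R. card (- R))"])
    show "\<exists>n. {} = rejected n" using rejected_0 by metis
  next
    fix R assume R: "\<exists>n. R = rejected n" "da_round pa pb R \<noteq> R"
    then show "\<exists>n. da_round pa pb R = rejected n" using rejected_Suc by metis
    have "R \<subset> da_round pa pb R" using R by (auto simp: da_round_def)
    then have "- da_round pa pb R \<subset> - R" by blast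
    then show "(da_round pa pb R, R) \<in> Wellfounded.measure (\<lambda>R. card (- R))"
      by (simp add: psubset_card_mono)
  qed (auto simp: rejected_Suc)
  then show ?thesis
    using that unfolding deferred_acceptance_def Let_def by metis
qed

lemma final_matching:
  assumes final: "rejected (Suc n) = rejected n"
  obtains f where "bij f" "\<And>a b. proposes n a b \<longleftrightarrow> f a = b"
proof -
  have uniq: "a = a'" if "proposes n a b" "proposes n a' b" for a a' b
  proof (rule ccontr)
    assume "a \<noteq> a'"
    then have "prefers (pb b) a a' \<or> prefers (pb b) a' a"
      by (rule prefers_total[OF complete_pb])
    then have "(a, b) \<in> rejected (Suc n) \<or> (a', b) \<in> rejected (Suc n)"
      using that by (auto simp: rejected_Suc_iff)
    moreover have "(a, b) \<notin> rejected n" "(a', b) \<notin> rejected n"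
      using that by (simp_all add: proposes_iff)
    ultimately show False by (simp add: final)
  qed
  \<comment> \<open>If everyone had rejected \<open>a\<close>, each receiver \<open>b\<close> would
    hold a better suitor \<open>g b\<close>. These suitors are distinct, so by equal cardinalities
    one of them is \<open>a\<close> himself.\<close>
  have total: "proposal pa (rejected n) a \<noteq> None" for a
  proof
    assume "proposal pa (rejected n) a = None"
    then have "(a, b) \<in> rejected n" for b using proposal_None_iff[of pa a] complete_pa by blast
    then have "\<forall>b. \<exists>a'. proposes n a' b \<and> prefers (pb b) a' a"
      using rejected_better_suitor by blast
    from choice[OF this] obtain g where "\<forall>b. proposes n (g b) b \<and> prefers (pb b) (g b) a" ..
    then have g: "\<And>b. proposes n (g b) b" "\<And>b. prefers (pb b) (g b) a" by simp_all
    have "inj g"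
    proof (rule injI)
      fix b b' assume "g b = g b'"
      then show "b = b'" using g(1)[of b] g(1)[of b'] by (metis option.inject)
    qed
    then have "card (range g) = CARD('a)" by (simp add: card_image card_eq)
    then have "range g = UNIV" by (rule card_subset_eq[OF finite subset_UNIV])
    then obtain b where "a = g b" by (rule surjE)
    then show False using g(2)[of b] prefers_irrefl[OF complete_pb[of b]] by simp
  qed
  define f where "f a = the (proposal pa (rejected n) a)" for a
  have f: "proposes n a b \<longleftrightarrow> f a = b" for a b
    using total[of a] by (auto simp: f_def)
  then have "inj f" using uniq by (metis injI)
  moreover from this have "card (range f) = CARD('b)" by (simp add: card_image card_eq)
  then have "range f = UNIV" by (rule card_subset_eq[OF finite subset_UNIV])
  ultimately have "bij f" by (simp add: bij_def)
  then show ?thesis using that f by blast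
qed

text \<open>With \<open>g\<close> a stable matching, this is the optimality of the outcome for the proposers.\<close>

lemma stable_partner_not_rejected:
  assumes "inj g"
    and stable: "\<And>a a'. \<not> (prefers (pa a') (g a) (g a') \<and> prefers (pb (g a)) a' a)"
  shows "(a, g a) \<notin> rejected n"
proof (induction n arbitrary: a)
  case (Suc n)
  show ?case
  proof
    assume "(a, g a) \<in> rejected (Suc n)"
    \<comment> \<open>The rival \<open>a'\<close> proposes to \<open>g a\<close> and, by the
      induction hypothesis, has not been rejected by \<open>g a'\<close>. So he prefers
      \<open>g a\<close>, and the two block \<open>g\<close>.\<close>
    then obtain a' where a': "proposes n a' (g a)" "prefers (pb (g a)) a' a"
      using Suc unfolding rejected_Suc_iff by blast
    then have "a' \<noteq> a" using prefers_irrefl[OF complete_pb] by metis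
    then have "g a' \<noteq> g a" using assms(1) by (metis injD)
    moreover have "\<not> prefers (pa a') (g a') (g a)"
      using a' Suc unfolding proposes_iff by blast
    ultimately show False using stable a' prefers_total[OF complete_pa] by metis
  qed
qed (simp add: rejected_0)

end

text \<open>
  Pairings are indexed by a third type: \<open>\<alpha> k\<close> is matched to \<open>\<beta> k\<close>. Taking \<open>\<alpha>\<close> or \<open>\<beta>\<close> to be the
  identity makes the results below apply to both sides of the market with a single index type.
\<close>

definition would_follow ::
    "('a \<Rightarrow> 'b list) \<Rightarrow> ('b \<Rightarrow> 'a list) \<Rightarrow> ('n \<Rightarrow> 'a) \<Rightarrow> ('n \<Rightarrow> 'b) \<Rightarrow> 'n \<Rightarrow> 'n \<Rightarrow> bool" where
  "would_follow pa pb \<alpha> \<beta> k l \<longleftrightarrow>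
     prefers (pa (\<alpha> l)) (\<beta> k) (\<beta> l) \<and> prefers (pb (\<beta> k)) (\<alpha> k) (\<alpha> l)"

text \<open>For a stable pairing, the cycles of this relation are the exposed rotations of stable
  matching theory, seen from the receivers. Eliminating one yields a stable pairing that is better
  for the proposers.\<close>

definition next_suitor ::
    "('a \<Rightarrow> 'b list) \<Rightarrow> ('b \<Rightarrow> 'a list) \<Rightarrow> ('n \<Rightarrow> 'a) \<Rightarrow> ('n \<Rightarrow> 'b) \<Rightarrow> 'n \<Rightarrow> 'n \<Rightarrow> bool" where
  "next_suitor pa pb \<alpha> \<beta> k l \<longleftrightarrow> would_follow pa pb \<alpha> \<beta> k l \<and>
     (\<forall>l'. would_follow pa pb \<alpha> \<beta> k l' \<longrightarrow> \<not> prefers (pb (\<beta> k)) (\<alpha> l') (\<alpha> l))"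

definition stable_pairing ::
    "('a \<Rightarrow> 'b list) \<Rightarrow> ('b \<Rightarrow> 'a list) \<Rightarrow> ('n \<Rightarrow> 'a) \<Rightarrow> ('n \<Rightarrow> 'b) \<Rightarrow> bool" where
  "stable_pairing pa pb \<alpha> \<beta> \<longleftrightarrow>
     (\<forall>k l. \<not> (prefers (pa (\<alpha> l)) (\<beta> k) (\<beta> l) \<and> prefers (pb (\<beta> k)) (\<alpha> l) (\<alpha> k)))"

text \<open>On a finite type such a set exists iff \<open>R\<close> has a cycle. Unlike cycles,
  these sets are preserved under nonempty unions, so that there is a largest one if there is
  any.\<close>

definition closed_set :: "('n \<Rightarrow> 'n \<Rightarrow> bool) \<Rightarrow> 'n set \<Rightarrow> bool" where
  "closed_set R C \<longleftrightarrow> C \<noteq> {} \<and> (\<forall>k\<in>C. \<exists>l\<in>C. R k l)"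

section \<open>The outcome as the stable pairing without closed sets\<close>

context deferred_acceptance_market
begin

text \<open>
  If \<open>\<beta> k\<close> is matched to \<open>\<alpha> k\<close>, her next suitor is the runner-up among all her proposers, hence is
  rejected only once \<open>\<alpha> k\<close> has proposed. So along \<open>next_suitor\<close> the rounds in which the
  final proposals are made increase strictly.
\<close>

lemma outcome_no_closed_set:
  fixes \<alpha> :: "'n::finite \<Rightarrow> 'a" and \<beta> :: "'n \<Rightarrow> 'b"
  assumes bij: "bij \<alpha>" "bij \<beta>"
    and final: "\<And>k. proposes N (\<alpha> k) (\<beta> k)"
  shows "\<not> closed_set (next_suitor pa pb \<alpha> \<beta>) C"
proof
  assume C: "closed_set (next_suitor pa pb \<alpha> \<beta>) C"
  \<comment> \<open>The first round in which \<open>\<alpha> k\<close> makes his final proposal; it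
    is at most \<open>N\<close>.\<close>
  define t where "t k = (LEAST n. proposes n (\<alpha> k) (\<beta> k))" for k
  have t: "proposes (t k) (\<alpha> k) (\<beta> k)" for k
    unfolding t_def using final by (rule LeastI)
  have t_le: "t k \<le> n" if "proposes n (\<alpha> k) (\<beta> k)" for k n
    unfolding t_def using that by (rule Least_le)
  have increasing: "t k < t l" if nxt: "next_suitor pa pb \<alpha> \<beta> k l" for k l
  proof -
    have "(\<alpha> l, \<beta> k) \<in> rejected (t l)"
      using t[of l] nxt unfolding proposes_iff next_suitor_def would_follow_def by blast
    then obtain m a where m: "m < t l" "proposes m a (\<beta> k)" "prefers (pb (\<beta> k)) a (\<alpha> l)"
      using rejected_by_earlier_proposal by blast
    obtain k' where k': "a = \<alpha> k'" using bij(1) by (metis bij_is_surj surjD)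
    \<comment> \<open>Otherwise \<open>\<alpha> k'\<close> visits \<open>\<beta> k\<close> but ends
      up with someone he likes less, so he would follow \<open>\<beta> k\<close>. As she prefers him
      to \<open>\<alpha> l\<close>, this contradicts the choice of \<open>l\<close> as her next
      suitor.\<close>
    have "k' = k"
    proof (rule ccontr)
      assume "k' \<noteq> k"
      then have neq: "\<beta> k' \<noteq> \<beta> k" "\<alpha> k' \<noteq> \<alpha> k" using bij by (simp_all add: bij_is_inj inj_eq)
      \<comment> \<open>He would have been rejected by his final partner by round \<open>m\<close>,
        and \<open>m < t l \<le> N\<close>.\<close>
      have "\<not> prefers (pa (\<alpha> k')) (\<beta> k') (\<beta> k)"
      proof
        assume "prefers (pa (\<alpha> k')) (\<beta> k') (\<beta> k)"
        then have *: "(\<alpha> k', \<beta> k') \<in> rejected m" using m k' proposes_iff by metis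
        show False
        proof (cases "m \<le> N")
          case True
          then show False using * rejected_mono final proposes_iff by blast
        next
          case False
          then have "N < t l" using m by simp
          then show False using t_le[OF final[of l]] by simp
        qed
      qed
      then have pref: "prefers (pa (\<alpha> k')) (\<beta> k) (\<beta> k')"
        using neq prefers_total[OF complete_pa] by metis
      then have "(\<alpha> k', \<beta> k) \<in> rejected N" using final proposes_iff by metis
      then obtain a'' where a'': "proposes N a'' (\<beta> k)" "prefers (pb (\<beta> k)) a'' (\<alpha> k')"
        using rejected_better_suitor by blast
      obtain k'' where k'': "a'' = \<alpha> k''" using bij(1) by (metis bij_is_surj surjD)
      then have "\<beta> k'' = \<beta> k" using final[of k''] a'' by simp
      then have "k'' = k" using bij(2) by (simp add: bij_is_inj inj_eq)
      then have "would_follow pa pb \<alpha> \<beta> k k'"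
        using a'' k'' pref unfolding would_follow_def by simp
      then show False using nxt m k' unfolding next_suitor_def by blast
    qed
    then show ?thesis using m k' t_le by (metis order_le_less_trans)
  qed
  have "t ` C \<noteq> {}" using C unfolding closed_set_def by blast
  then have "Max (t ` C) \<in> t ` C" by (intro Max_in) auto
  then obtain k where k: "k \<in> C" "t k = Max (t ` C)" by auto
  then have "\<And>l. l \<in> C \<Longrightarrow> t l \<le> t k" by simp
  then show False using k(1) C increasing unfolding closed_set_def by (meson not_le)
qed

text \<open>Conversely to \<open>outcome_no_closed_set\<close>, the indices at which a stable
  pairing differs from the outcome form a closed set as soon as there are any.\<close>

theorem deferred_acceptance_eq_iff:
  fixes \<alpha> :: "'n::finite \<Rightarrow> 'a" and \<beta> :: "'n \<Rightarrow> 'b"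
  assumes bij: "bij \<alpha>" "bij \<beta>"
  shows "deferred_acceptance pa pb = range (\<lambda>k. (\<alpha> k, \<beta> k)) \<longleftrightarrow>
    stable_pairing pa pb \<alpha> \<beta> \<and> (\<nexists>C. closed_set (next_suitor pa pb \<alpha> \<beta>) C)"
proof -
  obtain N where N: "rejected (Suc N) = rejected N" "deferred_acceptance pa pb = {(a, b). proposes N a b}"
    by (rule deferred_acceptance_terminates)
  obtain f where f: "bij f" "\<And>a b. proposes N a b \<longleftrightarrow> f a = b" by (rule final_matching[OF N(1)]) (rule that)
  have f_stable: "\<exists>a'. f a' = b \<and> prefers (pb b) a' a" if "prefers (pa a) b (f a)" for a b
  proof -
    have "(a, b) \<in> rejected N" using that f(2)[of a "f a"] unfolding proposes_iff by blast
    then show ?thesis using rejected_better_suitor[of a b N] unfolding f(2) by blast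
  qed
  have eq_iff: "deferred_acceptance pa pb = range (\<lambda>k. (\<alpha> k, \<beta> k)) \<longleftrightarrow> (\<forall>k. f (\<alpha> k) = \<beta> k)"
  proof
    assume "\<forall>k. f (\<alpha> k) = \<beta> k"
    then have "range (\<lambda>k. (\<alpha> k, \<beta> k)) = (\<lambda>a. (a, f a)) ` range \<alpha>" by (simp add: image_image)
    also have "\<dots> = {(a, b). f a = b}" unfolding bij_is_surj[OF bij(1)] by auto
    finally show "deferred_acceptance pa pb = range (\<lambda>k. (\<alpha> k, \<beta> k))"
      unfolding N(2) f(2) ..
  next
    assume "deferred_acceptance pa pb = range (\<lambda>k. (\<alpha> k, \<beta> k))"
    then have eq: "{(a, b). f a = b} = range (\<lambda>k. (\<alpha> k, \<beta> k))" unfolding N(2) f(2) .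
    have "(\<alpha> k, \<beta> k) \<in> {(a, b). f a = b}" for k unfolding eq by (rule rangeI)
    then show "\<forall>k. f (\<alpha> k) = \<beta> k" by simp
  qed
  show ?thesis unfolding eq_iff
  proof
    assume eq: "\<forall>k. f (\<alpha> k) = \<beta> k"
    have "stable_pairing pa pb \<alpha> \<beta>"
      unfolding stable_pairing_def
    proof (intro allI notI)
      fix k l assume A: "prefers (pa (\<alpha> l)) (\<beta> k) (\<beta> l) \<and> prefers (pb (\<beta> k)) (\<alpha> l) (\<alpha> k)"
      then obtain a' where "f a' = \<beta> k" "prefers (pb (\<beta> k)) a' (\<alpha> l)" using f_stable eq by metis
      moreover have "a' = \<alpha> k" using calculation(1) eq inj_eq[OF bij_is_inj[OF f(1)]] by metis
      ultimately show False using A prefers_asym[OF complete_pb] by blast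
    qed
    then show "stable_pairing pa pb \<alpha> \<beta> \<and> (\<nexists>C. closed_set (next_suitor pa pb \<alpha> \<beta>) C)"
      using outcome_no_closed_set[OF bij, of N] f(2) eq by blast
  next
    assume asm: "stable_pairing pa pb \<alpha> \<beta> \<and> (\<nexists>C. closed_set (next_suitor pa pb \<alpha> \<beta>) C)"
    define C where "C = {k. f (\<alpha> k) \<noteq> \<beta> k}"
    have "\<exists>l\<in>C. next_suitor pa pb \<alpha> \<beta> k l" if "k \<in> C" for k
    proof -
      \<comment> \<open>The outcome gives \<open>\<beta> k\<close> to \<open>\<alpha> k'\<close>.
        Since the proposers do at least as well in the outcome, he prefers her to
        \<open>\<beta> k'\<close>, and stability of the pairing makes her prefer
        \<open>\<alpha> k\<close> to him. So she has a candidate, and the best one is her next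
        suitor.\<close>
      obtain k' where k': "f (\<alpha> k') = \<beta> k" using bij_is_surj[OF f(1)] bij_is_surj[OF bij(1)] by (metis surjD)
      then have neq: "k' \<noteq> k" "\<beta> k \<noteq> \<beta> k'" "\<alpha> k \<noteq> \<alpha> k'"
        using that bij unfolding C_def by (auto simp: bij_is_inj inj_eq)
      have "(\<alpha> k', (\<beta> \<circ> inv \<alpha>) (\<alpha> k')) \<notin> rejected N"
      proof (rule stable_partner_not_rejected)
        show "inj (\<beta> \<circ> inv \<alpha>)" using bij by (simp add: bij_is_inj bij_imp_bij_inv inj_compose)
        fix a a'
        show "\<not> (prefers (pa a') ((\<beta> \<circ> inv \<alpha>) a) ((\<beta> \<circ> inv \<alpha>) a') \<and>
                 prefers (pb ((\<beta> \<circ> inv \<alpha>) a)) a' a)"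
          using asm surj_f_inv_f[OF bij_is_surj[OF bij(1)]] unfolding stable_pairing_def comp_apply by metis
      qed
      then have "(\<alpha> k', \<beta> k') \<notin> rejected N" using bij by (simp add: bij_is_inj)
      then have pref: "prefers (pa (\<alpha> k')) (\<beta> k) (\<beta> k')"
        using neq k' f(2) proposes_iff prefers_total[OF complete_pa] by metis
      then have "would_follow pa pb \<alpha> \<beta> k k'"
        unfolding would_follow_def using asm neq prefers_total[OF complete_pb]
        unfolding stable_pairing_def by metis
      then have "\<alpha> ` Collect (would_follow pa pb \<alpha> \<beta> k) \<noteq> {}" by blast
      from prefers_best[OF complete_pb[of "\<beta> k"] this] obtain l where l: "would_follow pa pb \<alpha> \<beta> k l"
        "\<And>l'. would_follow pa pb \<alpha> \<beta> k l' \<Longrightarrow> \<not> prefers (pb (\<beta> k)) (\<alpha> l') (\<alpha> l)"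
        by blast
      \<comment> \<open>If \<open>\<alpha> l\<close> had \<open>\<beta> l\<close> in the outcome,
        stability of the outcome would make \<open>\<alpha> k'\<close> a better candidate for
        \<open>\<beta> k\<close> than \<open>\<alpha> l\<close>.\<close>
      have "l \<in> C"
      proof (rule ccontr)
        assume "l \<notin> C"
        then have "\<exists>a'. f a' = \<beta> k \<and> prefers (pb (\<beta> k)) a' (\<alpha> l)"
          using f_stable l(1) unfolding would_follow_def C_def by simp
        then have "prefers (pb (\<beta> k)) (\<alpha> k') (\<alpha> l)" using k' inj_eq[OF bij_is_inj[OF f(1)]] by metis
        then show False using l(2) \<open>would_follow pa pb \<alpha> \<beta> k k'\<close> by blast
      qed
      then show ?thesis using l unfolding next_suitor_def by blast
    qed
    then have "C = {}" using asm unfolding closed_set_def by blast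
    then show "\<forall>k. f (\<alpha> k) = \<beta> k" unfolding C_def by blast
  qed
qed

lemma deferred_acceptance_bij:
  obtains f where "bij f" "deferred_acceptance pa pb = {(a, b). f a = b}"
proof -
  obtain n where n: "rejected (Suc n) = rejected n"
    "deferred_acceptance pa pb = {(a, b). proposes n a b}"
    by (rule deferred_acceptance_terminates)
  obtain f where "bij f" "\<And>a b. proposes n a b \<longleftrightarrow> f a = b"
    by (rule final_matching[OF n(1)]) (rule that)
  then show ?thesis using that n(2) by simp
qed

end

section \<open>Inclusion-exclusion over cycles\<close>

text \<open>This is -1 to the number of nontrivial cycles: a cycle of length j contributes
  (-1)^(j-1) to the sign and (-1)^j to the second factor.\<close>

definition cover_sign :: "('n::finite \<Rightarrow> 'n) \<Rightarrow> real" where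
  "cover_sign \<sigma> = of_int (sign \<sigma>) * (- 1) ^ card {k. \<sigma> k \<noteq> k}"

lemma cover_sign_inv:
  assumes "\<sigma> permutes UNIV"
  shows "cover_sign (inv \<sigma>) = cover_sign \<sigma>"
proof -
  have "(inv \<sigma> k \<noteq> k) = (\<sigma> k \<noteq> k)" for k using permutes_inv_eq[OF assms] by metis
  moreover have "sign (inv \<sigma>) = sign \<sigma>"
    using sign_inverse[OF permutes_imp_permutation[OF finite assms]] .
  ultimately show ?thesis by (simp add: cover_sign_def)
qed

text \<open>
  The sum is the Leibniz expansion of \<open>det (1 - A)\<close> for the adjacency matrix \<open>A\<close> of the
  partial function \<open>R\<close>. The indicator of the largest closed set is a kernel vector of \<open>1 - A\<close>.
\<close>

lemma sum_cover_sign: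
  fixes R :: "'n::finite \<Rightarrow> 'n \<Rightarrow> bool"
  assumes single: "\<And>k l l'. R k l \<Longrightarrow> R k l' \<Longrightarrow> l = l'" and irrefl: "\<And>k. \<not> R k k"
  shows "(\<Sum>\<sigma> | \<sigma> permutes UNIV. cover_sign \<sigma> * of_bool (\<forall>k. \<sigma> k \<noteq> k \<longrightarrow> R k (\<sigma> k)))
    = of_bool (\<nexists>C. closed_set R C)"
proof (cases "\<exists>C. closed_set R C")
  case False
  \<comment> \<open>The points moved by a contributing permutation would form a closed set, so only
    the identity contributes.\<close>
  have "cover_sign \<sigma> * of_bool (\<forall>k. \<sigma> k \<noteq> k \<longrightarrow> R k (\<sigma> k)) = (if \<sigma> = id then 1 else 0)"
    if \<sigma>: "\<sigma> permutes UNIV" for \<sigma> :: "'n \<Rightarrow> 'n"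
  proof (cases "\<sigma> = id")
    case True
    then show ?thesis by (simp add: cover_sign_def)
  next
    case neq: False
    have "\<not> (\<forall>k. \<sigma> k \<noteq> k \<longrightarrow> R k (\<sigma> k))"
    proof
      assume "\<forall>k. \<sigma> k \<noteq> k \<longrightarrow> R k (\<sigma> k)"
      moreover have "{k. \<sigma> k \<noteq> k} \<noteq> {}" using neq by (auto simp: fun_eq_iff)
      moreover have "\<sigma> (\<sigma> k) \<noteq> \<sigma> k" if "\<sigma> k \<noteq> k" for k
        using that inj_eq[OF permutes_inj[OF \<sigma>]] by simp
      ultimately have "closed_set R {k. \<sigma> k \<noteq> k}" unfolding closed_set_def by auto
      then show False using False by simp
    qed
    then show ?thesis using neq by simp
  qed
  then have "(\<Sum>\<sigma> | \<sigma> permutes UNIV. cover_sign \<sigma> * of_bool (\<forall>k. \<sigma> k \<noteq> k \<longrightarrow> R k (\<sigma> k)))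
      = (\<Sum>\<sigma> | \<sigma> permutes (UNIV :: 'n set). if \<sigma> = id then 1 else 0)"
    by (intro sum.cong) auto
  also have "\<dots> = 1" by (simp add: finite_permutations permutes_id)
  finally show ?thesis using False by simp
next
  case True
  define A :: "real ^ 'n ^ 'n" where
    "A = (\<chi> k l. if l = k then 1 else - of_bool (R k l))"
  define C where "C = \<Union> {C. closed_set R C}"
  define v :: "real ^ 'n" where "v = (\<chi> k. of_bool (k \<in> C))"
  \<comment> \<open>Maximality of \<open>C\<close> gives the backward direction. Hence
    \<open>v\<close> takes the same value at \<open>k\<close> and at its \<open>R\<close>-successor,
    and vanishes at \<open>k\<close> if there is none.\<close>
  have C_iff: "k \<in> C \<longleftrightarrow> (\<exists>l\<in>C. R k l)" for k
  proof
    assume "\<exists>l\<in>C. R k l"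
    then obtain l D where "R k l" "l \<in> D" "closed_set R D" unfolding C_def by auto
    then have "closed_set R (insert k D)" unfolding closed_set_def by auto
    then show "k \<in> C" unfolding C_def by auto
  qed (auto simp: C_def closed_set_def)
  have "(A *v v) $ k = 0" for k
  proof -
    have "(A *v v) $ k = (\<Sum>l\<in>UNIV. (if l = k then of_bool (k \<in> C) else 0) - of_bool (l \<in> C \<and> R k l))"
      unfolding matrix_vector_mult_def vec_lambda_beta
      by (intro sum.cong refl) (auto simp: A_def v_def irrefl)
    also have "\<dots> = of_bool (k \<in> C) - (\<Sum>l\<in>UNIV. of_bool (l \<in> C \<and> R k l))"
      by (simp add: sum_subtractf)
    also have "(\<Sum>l\<in>UNIV. of_bool (l \<in> C \<and> R k l) :: real) = of_bool (k \<in> C)"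
    proof (cases "k \<in> C")
      case True
      then obtain l where "l \<in> C" "R k l" using C_iff by blast
      then have "(l' \<in> C \<and> R k l') = (l' = l)" for l' using single by blast
      then show ?thesis using True by simp
    next
      case False
      then have "(l \<in> C \<and> R k l) = False" for l using C_iff[of k] by blast
      then show ?thesis using False by simp
    qed
    finally show ?thesis by simp
  qed
  then have "A *v v = 0" by (simp add: vec_eq_iff)
  moreover have "v \<noteq> 0"
    using True unfolding v_def C_def closed_set_def by (auto simp: vec_eq_iff)
  ultimately have "det A = 0"
    using matrix_left_invertible_ker[of A] invertible_det_nz[of A] invertible_left_inverse[of A] by blast
  moreover have "det A = (\<Sum>\<sigma> | \<sigma> permutes UNIV. cover_sign \<sigma> * of_bool (\<forall>k. \<sigma> k \<noteq> k \<longrightarrow> R k (\<sigma> k)))"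
    unfolding det_def
  proof (rule sum.cong[OF refl])
    fix \<sigma> :: "'n \<Rightarrow> 'n"
    have "(\<Prod>k\<in>UNIV. A $ k $ \<sigma> k) = (- 1) ^ card {k. \<sigma> k \<noteq> k} * of_bool (\<forall>k. \<sigma> k \<noteq> k \<longrightarrow> R k (\<sigma> k))"
    proof (cases "\<forall>k. \<sigma> k \<noteq> k \<longrightarrow> R k (\<sigma> k)")
      case True
      then have "(\<Prod>k\<in>UNIV. A $ k $ \<sigma> k) = (\<Prod>k\<in>UNIV. if \<sigma> k \<noteq> k then - 1 else 1)"
        unfolding A_def by (intro prod.cong) auto
      also have "\<dots> = (- 1) ^ card {k. \<sigma> k \<noteq> k}"
        by (subst prod.If_cases) auto
      finally show ?thesis using True by simp
    next
      case False
      then obtain k where "\<sigma> k \<noteq> k" "\<not> R k (\<sigma> k)" by blast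
      then have "A $ k $ \<sigma> k = 0" by (simp add: A_def)
      then have "(\<Prod>k\<in>UNIV. A $ k $ \<sigma> k) = 0" by (intro prod_zero) auto
      then show ?thesis unfolding of_bool_eq_0_iff[THEN iffD2, OF False] by simp
    qed
    then show "of_int (sign \<sigma>) * (\<Prod>k\<in>UNIV. A $ k $ \<sigma> k) =
        cover_sign \<sigma> * of_bool (\<forall>k. \<sigma> k \<noteq> k \<longrightarrow> R k (\<sigma> k))"
      by (simp add: cover_sign_def)
  qed
  ultimately show ?thesis using True by simp
qed

section \<open>Sampling without replacement\<close>

lemma prob_bind_pmf_finite:
  assumes "finite (set_pmf M)"
  shows "measure_pmf.prob (bind_pmf M f) A = (\<Sum>x\<in>set_pmf M. pmf M x * measure_pmf.prob (f x) A)"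
proof -
  have "ennreal (measure_pmf.prob (bind_pmf M f) A) = (\<integral>\<^sup>+x. ennreal (measure_pmf.prob (f x) A) \<partial>M)"
    by (simp flip: measure_pmf.emeasure_eq_measure)
  also have "\<dots> = ennreal (\<integral>x. measure_pmf.prob (f x) A \<partial>M)"
    by (intro nn_integral_eq_integral measure_pmf.integrable_const_bound[where B = 1]) auto
  finally have "measure_pmf.prob (bind_pmf M f) A = (\<integral>x. measure_pmf.prob (f x) A \<partial>M)"
    by (simp add: integral_nonneg)
  then show ?thesis by (simp add: integral_measure_pmf[OF assms] mult.commute)
qed

context
  fixes f :: "'a \<Rightarrow> real"
  assumes f_pos: "\<And>x. f x > 0"
begin

lemma set_pmf_weighted_pmf: "finite A \<Longrightarrow> A \<noteq> {} \<Longrightarrow> set_pmf (weighted_pmf f A) = A"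
  using f_pos sum_pos[of A f] by (auto simp: set_pmf_eq pmf_weighted_pmf less_le)

lemma prob_draws_Cons:
  assumes "finite A" "x \<in> A"
  shows "measure_pmf.prob (sample_without_replacement (Suc n) f A) {xs. prefix (x # us) xs} =
    f x / sum f A * measure_pmf.prob (sample_without_replacement n f (A - {x})) {xs. prefix us xs}"
proof -
  have ne: "A \<noteq> {}" using assms by auto
  have "measure_pmf.prob (sample_without_replacement (Suc n) f A) {xs. prefix (x # us) xs}
    = (\<Sum>y\<in>A. f y / sum f A *
        measure_pmf.prob (sample_without_replacement n f (A - {y})) {xs. x = y \<and> prefix us xs})"
    using assms ne
    by (simp add: prob_bind_pmf_finite set_pmf_weighted_pmf pmf_weighted_pmf f_pos vimage_def)
  also have "\<dots> = (\<Sum>y\<in>A. if y = x then f x / sum f A *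
      measure_pmf.prob (sample_without_replacement n f (A - {x})) {xs. prefix us xs} else 0)"
    by (intro sum.cong) auto
  also have "\<dots> = f x / sum f A *
      measure_pmf.prob (sample_without_replacement n f (A - {x})) {xs. prefix us xs}"
    using assms by simp
  finally show ?thesis .
qed

text \<open>Covers prefixes that cannot be drawn, so that \<open>us\<close> may be arbitrary in
  \<open>prob_next_draw_swap\<close>.\<close>

lemma prob_draws_Cons_notin:
  assumes "finite A" "A \<noteq> {}" "x \<notin> A"
  shows "measure_pmf.prob (sample_without_replacement (Suc n) f A) {xs. prefix (x # us) xs} = 0"
proof -
  have "measure_pmf.prob (sample_without_replacement (Suc n) f A) {xs. prefix (x # us) xs}
    = (\<Sum>y\<in>A. f y / sum f A *
        measure_pmf.prob (sample_without_replacement n f (A - {y})) {xs. x = y \<and> prefix us xs})"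
    using assms
    by (simp add: prob_bind_pmf_finite set_pmf_weighted_pmf pmf_weighted_pmf f_pos vimage_def)
  also have "\<dots> = 0"
  proof (intro sum.neutral ballI)
    fix y assume "y \<in> A"
    then have "x \<noteq> y" using assms(3) by auto
    then show "f y / sum f A *
      measure_pmf.prob (sample_without_replacement n f (A - {y})) {xs. x = y \<and> prefix us xs} = 0"
      by simp
  qed
  finally show ?thesis .
qed

text \<open>After the same initial draws, the two candidates compete with the same total weight.\<close>

lemma prob_next_draw_swap:
  assumes "finite A" "p \<in> A - set us" "q \<in> A - set us"
  shows "measure_pmf.prob (sample_without_replacement n f A) {xs. prefix (us @ [p]) xs} * f q =
    measure_pmf.prob (sample_without_replacement n f A) {xs. prefix (us @ [q]) xs} * f p"
  using assms
proof (induction us arbitrary: A n)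
  case Nil
  then show ?case
  proof (cases n)
    case (Suc n')
    then show ?thesis using Nil
      by (simp add: prob_draws_Cons del: sample_without_replacement.simps(2))
  next
    case 0
    then show ?thesis by simp
  qed
next
  case (Cons u us)
  show ?case
  proof (cases n)
    case (Suc n')
    show ?thesis
    proof (cases "u \<in> A")
      case True
      then show ?thesis using Cons.IH[of "A - {u}" n'] Cons.prems
        by (simp add: Suc prob_draws_Cons mult.assoc del: sample_without_replacement.simps(2))
    next
      case False
      have "A \<noteq> {}" using Cons.prems by auto
      then show ?thesis using False Cons.prems(1)
        by (simp add: Suc prob_draws_Cons_notin del: sample_without_replacement.simps(2))
    qed
  next
    case 0
    then show ?thesis by simp
  qed
qed

lemma set_pmf_sample_without_replacement:
  assumes "finite A" "xs \<in> set_pmf (sample_without_replacement (card A) f A)"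
  shows "distinct xs \<and> set xs = A"
  using assms
proof (induction "card A" arbitrary: A xs)
  case (Suc n)
  then have ne: "A \<noteq> {}" by auto
  from Suc.prems obtain x ys where x: "x \<in> A" "xs = x # ys"
    "ys \<in> set_pmf (sample_without_replacement n f (A - {x}))"
    by (auto simp flip: Suc.hyps(2) simp: set_pmf_weighted_pmf ne)
  moreover have "n = card (A - {x})" using Suc.hyps(2) Suc.prems(1) x(1) by simp
  ultimately have "distinct ys \<and> set ys = A - {x}" using Suc.hyps(1)[of "A - {x}" ys] Suc.prems(1) by simp
  then show ?case using x by auto
next
  case 0
  then have "A = {}" by simp
  then show ?case using "0.prems"(2) by simp
qed

end

lemma complete_anti_popularity_list:
  assumes "\<And>x. p x > 0" "l \<in> set_pmf (anti_popularity_list p)"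
  shows "complete_list l"
  using assms(2) set_pmf_sample_without_replacement[of "\<lambda>x. 1 / p x" UNIV] assms(1)
  unfolding anti_popularity_list_def complete_list_def by auto

text \<open>\<open>rev l\<close> is the order of the draws, and the weights are
  \<open>1 / p\<close>, so multiplying by the other weight becomes a division by
  \<open>p\<close>.\<close>

lemma prob_anti_popularity_list_swap:
  assumes "\<And>x. p x > 0" "u \<notin> set us" "v \<notin> set us"
  shows "measure_pmf.prob (anti_popularity_list p) {l. prefix (us @ [u]) (rev l)} / p v =
    measure_pmf.prob (anti_popularity_list p) {l. prefix (us @ [v]) (rev l)} / p u"
  using prob_next_draw_swap[of "\<lambda>x. 1 / p x" UNIV u us v "CARD('a)"] assms
  unfolding anti_popularity_list_def by (simp add: vimage_def)

section \<open>Reversing the order of two options\<close>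

text \<open>
  Exchanging \<open>u\<close> with \<open>v\<close> and \<open>x\<close> with \<open>y\<close> turns the summand of a permutation for one proposing side
  into that of its inverse for the other side.
\<close>

definition swap_event :: "('m \<Rightarrow> 'w) \<Rightarrow> ('m \<Rightarrow> 'w) \<Rightarrow> ('w \<Rightarrow> 'm) \<Rightarrow> ('w \<Rightarrow> 'm) \<Rightarrow>
    (('m \<Rightarrow> 'w list) \<times> ('w \<Rightarrow> 'm list)) set" where
  "swap_event u v x y = {(men, women).
     (\<forall>m. v m = u m \<or> prefers (men m) (v m) (u m)) \<and>
     (\<forall>w. y w = x w \<or> prefers (women w) (y w) (x w)) \<and>
     (\<forall>m w. w \<notin> {u m, v m} \<longrightarrow> m \<notin> {x w, y w} \<longrightarrow>
        \<not> (prefers (men m) w (u m) \<and> prefers (women w) m (x w)))}"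

text \<open>What is drawn after \<open>u\<close> is preferred to \<open>u\<close>; by completeness
  this is everything except \<open>u\<close> and the earlier draws \<open>us\<close>.\<close>

lemma prefers_rev:
  assumes "complete_list l" "rev l = us @ u # zs"
  shows "prefers l w u \<longleftrightarrow> w \<noteq> u \<and> w \<notin> set us"
proof -
  have l: "l = rev zs @ u # rev us" using assms(2) by (metis append.assoc append_Cons append_Nil rev.simps(2) rev_append rev_rev_ident)
  obtain r :: "'a \<Rightarrow> nat" where r: "\<And>x. r x < length l" "\<And>x. l ! r x = x"
    "\<And>i. i < length l \<Longrightarrow> r (l ! i) = i" "\<And>x y. prefers l x y \<longleftrightarrow> r x < r y"
    by (rule complete_list_rank[OF assms(1)]) (rule that)
  have "l ! length zs = u" by (simp add: l nth_append)
  then have ru: "r u = length zs" using r(3)[of "length zs"] by (simp add: l)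
  have dist: "distinct (rev zs @ u # rev us)" and UNIV: "set (rev zs @ u # rev us) = UNIV"
    using assms(1) unfolding complete_list_def l by auto
  have "r w < length zs \<longleftrightarrow> w \<in> set zs"
  proof
    assume "r w < length zs"
    then show "w \<in> set zs"
      using r(2)[of w] nth_mem[of "r w" "rev zs"] by (simp add: l nth_append)
  next
    assume "w \<in> set zs"
    then obtain i where "i < length zs" "rev zs ! i = w" by (metis in_set_conv_nth length_rev set_rev)
    then show "r w < length zs" using r(3)[of i] by (simp add: l nth_append)
  qed
  moreover have "w \<in> set zs \<longleftrightarrow> w \<noteq> u \<and> w \<notin> set us" using dist UNIV by auto
  ultimately show ?thesis by (simp add: r(4) ru)
qed

text \<open>Here \<open>us\<close> consists of the draws before \<open>u\<close>, and the right-hand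
  side says that \<open>v\<close> is not among them. The length bound keeps the candidates for
  \<open>us\<close> finite in number.\<close>

lemma prefers_iff_draws:
  assumes "complete_list l"
  shows "v = u \<or> prefers l v u \<longleftrightarrow>
    (\<exists>us. length us \<le> length l \<and> u \<notin> set us \<and> v \<notin> set us \<and> prefix (us @ [u]) (rev l))"
proof
  assume A: "v = u \<or> prefers l v u"
  have "u \<in> set (rev l)" using assms unfolding complete_list_def by simp
  then obtain us zs where us: "rev l = us @ u # zs" "u \<notin> set us" by (metis split_list_first)
  then have "v \<notin> set us" using A prefers_rev[OF assms us(1)] by auto
  moreover have "length us \<le> length l" using arg_cong[OF us(1), of length] by simp
  ultimately show "\<exists>us. length us \<le> length l \<and> u \<notin> set us \<and> v \<notin> set us \<and> prefix (us @ [u]) (rev l)"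
    using us by (auto intro!: exI[of _ us])
next
  assume "\<exists>us. length us \<le> length l \<and> u \<notin> set us \<and> v \<notin> set us \<and> prefix (us @ [u]) (rev l)"
  then obtain us zs where "v \<notin> set us" "rev l = us @ u # zs" by (auto simp: prefix_def)
  then show "v = u \<or> prefers l v u" using prefers_rev[OF assms] by auto
qed

text \<open>
  \<open>V m\<close> lists what \<open>m\<close> draws before the first of \<open>u m\<close> and \<open>v m\<close>, that is, what he likes less than
  both. These lists determine whether a profile in which \<open>u m\<close> and \<open>x w\<close> are drawn next
  belongs to \<open>swap_event u v x y\<close>.
\<close>

definition late_draws :: "('m \<Rightarrow> 'w) \<Rightarrow> ('m \<Rightarrow> 'w) \<Rightarrow> ('w \<Rightarrow> 'm) \<Rightarrow> ('w \<Rightarrow> 'm) \<Rightarrow>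
    (('m \<Rightarrow> 'w list) \<times> ('w \<Rightarrow> 'm list)) set" where
  "late_draws u v x y = {(V, Z).
     (\<forall>m. length (V m) \<le> CARD('w) \<and> u m \<notin> set (V m) \<and> v m \<notin> set (V m)) \<and>
     (\<forall>w. length (Z w) \<le> CARD('m) \<and> x w \<notin> set (Z w) \<and> y w \<notin> set (Z w)) \<and>
     (\<forall>m w. w \<notin> {u m, v m} \<longrightarrow> m \<notin> {x w, y w} \<longrightarrow> w \<in> set (V m) \<or> m \<in> set (Z w))}"

text \<open>The conditions do not tell which of the two options is drawn next, so one index set
  serves both an event and its reversal.\<close>

lemma late_draws_commute: "late_draws u v x y = late_draws v u y x"
  unfolding late_draws_def by (intro Collect_cong) auto

lemma finite_functions: "finite A \<Longrightarrow> finite {f :: 'a::finite \<Rightarrow> 'b. \<forall>x. f x \<in> A}"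
  using finite_PiE[of "UNIV :: 'a set" "\<lambda>_. A"] by (simp add: PiE_UNIV_domain Pi_def)

lemma finite_late_draws:
  fixes u :: "'m::finite \<Rightarrow> 'w::finite"
  shows "finite (late_draws u v x y)"
proof (rule finite_subset)
  show "late_draws u v x y \<subseteq>
    {V. \<forall>m. V m \<in> {us. set us \<subseteq> UNIV \<and> length us \<le> CARD('w)}} \<times>
    {Z. \<forall>w. Z w \<in> {us. set us \<subseteq> UNIV \<and> length us \<le> CARD('m)}}"
    unfolding late_draws_def by auto
qed (intro finite_cartesian_product finite_functions finite_lists_length_le finite)

text \<open>A product over all agents, so that its probability factors by independence of the
  lists.\<close>

definition late_box :: "('m \<Rightarrow> 'w) \<Rightarrow> ('w \<Rightarrow> 'm) \<Rightarrow> ('m \<Rightarrow> 'w list) \<times> ('w \<Rightarrow> 'm list) \<Rightarrow>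
    (('m \<Rightarrow> 'w list) \<times> ('w \<Rightarrow> 'm list)) set" where
  "late_box u x VZ = (\<Pi> m\<in>UNIV. {l. prefix (fst VZ m @ [u m]) (rev l)}) \<times>
     (\<Pi> w\<in>UNIV. {l. prefix (snd VZ w @ [x w]) (rev l)})"

lemma complete_list_length: "complete_list (l :: 'a::finite list) \<Longrightarrow> length l = CARD('a)"
  unfolding complete_list_def using distinct_card by metis

lemma swap_event_iff_late_box:
  fixes men :: "'m::finite \<Rightarrow> 'w::finite list" and women :: "'w \<Rightarrow> 'm list"
  assumes men: "\<And>m. complete_list (men m)" and women: "\<And>w. complete_list (women w)"
  shows "(men, women) \<in> swap_event u v x y \<longleftrightarrow>
    (men, women) \<in> (\<Union>VZ\<in>late_draws u v x y. late_box u x VZ)"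
proof
  assume ev: "(men, women) \<in> swap_event u v x y"
  have "\<forall>m. \<exists>us. length us \<le> CARD('w) \<and> u m \<notin> set us \<and> v m \<notin> set us \<and> prefix (us @ [u m]) (rev (men m))"
    using ev prefers_iff_draws[OF men] unfolding swap_event_def by (simp add: complete_list_length[OF men])
  then obtain V where V: "\<And>m. length (V m) \<le> CARD('w)" "\<And>m. u m \<notin> set (V m)" "\<And>m. v m \<notin> set (V m)"
    "\<And>m. prefix (V m @ [u m]) (rev (men m))" by metis
  have "\<forall>w. \<exists>us. length us \<le> CARD('m) \<and> x w \<notin> set us \<and> y w \<notin> set us \<and> prefix (us @ [x w]) (rev (women w))"
    using ev prefers_iff_draws[OF women] unfolding swap_event_def by (simp add: complete_list_length[OF women])
  then obtain Z where Z: "\<And>w. length (Z w) \<le> CARD('m)" "\<And>w. x w \<notin> set (Z w)" "\<And>w. y w \<notin> set (Z w)"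
    "\<And>w. prefix (Z w @ [x w]) (rev (women w))" by metis
  \<comment> \<open>Outside the two options, being preferred to the next draw means not being among
    the late draws.\<close>
  have "w \<in> set (V m) \<or> m \<in> set (Z w)" if "w \<notin> {u m, v m}" "m \<notin> {x w, y w}" for m w
  proof -
    obtain zs where "rev (men m) = V m @ u m # zs" using V(4)[of m] by (auto simp: prefix_def)
    note * = prefers_rev[OF men this]
    obtain zs where "rev (women w) = Z w @ x w # zs" using Z(4)[of w] by (auto simp: prefix_def)
    note ** = prefers_rev[OF women this]
    have "\<not> (prefers (men m) w (u m) \<and> prefers (women w) m (x w))"
      using ev that unfolding swap_event_def by blast
    then show ?thesis using * ** that by simp
  qed
  then have "(V, Z) \<in> late_draws u v x y" unfolding late_draws_def using V Z by simp
  moreover have "(men, women) \<in> late_box u x (V, Z)" unfolding late_box_def using V(4) Z(4) by simp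
  ultimately show "(men, women) \<in> (\<Union>VZ\<in>late_draws u v x y. late_box u x VZ)" by blast
next
  assume "(men, women) \<in> (\<Union>VZ\<in>late_draws u v x y. late_box u x VZ)"
  then obtain V Z where VZ: "(V, Z) \<in> late_draws u v x y" "(men, women) \<in> late_box u x (V, Z)" by auto
  have m: "\<exists>zs. rev (men m) = V m @ u m # zs" for m
    using VZ(2) unfolding late_box_def by (auto simp: prefix_def Pi_iff)
  have w: "\<exists>zs. rev (women w) = Z w @ x w # zs" for w
    using VZ(2) unfolding late_box_def by (auto simp: prefix_def Pi_iff)
  have *: "prefers (men m) w (u m) \<longleftrightarrow> w \<noteq> u m \<and> w \<notin> set (V m)" for m w
    using m prefers_rev[OF men] by metis
  have **: "prefers (women w) m (x w) \<longleftrightarrow> m \<noteq> x w \<and> m \<notin> set (Z w)" for m w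
    using w prefers_rev[OF women] by metis
  show "(men, women) \<in> swap_event u v x y"
    using VZ(1) by (auto simp: swap_event_def late_draws_def * **)
qed

text \<open>The draws before the first occurrence of \<open>u m\<close> or \<open>x w\<close> can be
  read off from the profile, so it lies in at most one box.\<close>

lemma disjoint_late_boxes: "disjoint_family_on (late_box u x) (late_draws u v x y)"
proof (unfold disjoint_family_on_def, intro ballI impI)
  have takeWhile_eq: "takeWhile (\<lambda>z. z \<noteq> a) l = us" if pre: "prefix (us @ [a]) l" and a: "a \<notin> set us"
    for us :: "'c list" and a l
  proof -
    obtain zs where "l = us @ a # zs" using pre by (auto simp: prefix_def)
    moreover have "\<forall>z\<in>set us. z \<noteq> a" using a by auto
    ultimately show ?thesis by (simp add: takeWhile_append2)
  qed
  have unique: "us = vs" if "prefix (us @ [a]) l" "prefix (vs @ [a]) l" "a \<notin> set us" "a \<notin> set vs"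
    for us vs :: "'c list" and a l
    using takeWhile_eq[OF that(1,3)] takeWhile_eq[OF that(2,4)] by simp
  fix VZ VZ' assume VZ: "VZ \<in> late_draws u v x y" "VZ' \<in> late_draws u v x y" "VZ \<noteq> VZ'"
  show "late_box u x VZ \<inter> late_box u x VZ' = {}"
  proof (rule ccontr)
    assume "late_box u x VZ \<inter> late_box u x VZ' \<noteq> {}"
    then obtain p where p: "p \<in> late_box u x VZ" "p \<in> late_box u x VZ'" by blast
    have "fst VZ m = fst VZ' m" for m
      using p VZ by (intro unique[of _ "u m" "rev (fst p m)"]) (auto simp: late_box_def late_draws_def)
    moreover have "snd VZ w = snd VZ' w" for w
      using p VZ by (intro unique[of _ "x w" "rev (snd p w)"]) (auto simp: late_box_def late_draws_def)
    ultimately show False using VZ(3) by (simp add: prod_eq_iff fun_eq_iff)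
  qed
qed

context
  fixes P :: "'m::finite \<Rightarrow> 'w::finite \<Rightarrow> real"
  assumes P_pos: "\<And>m w. P m w > 0"
begin

lemma complete_profile:
  assumes "(men, women) \<in> set_pmf (anti_popularity_profile P)"
  shows "complete_list (men m)" "complete_list (women w)"
  using assms complete_anti_popularity_list[of "P m", OF P_pos]
    complete_anti_popularity_list[of "\<lambda>m. P m w", OF P_pos]
  unfolding anti_popularity_profile_def by (auto simp: set_Pi_pmf PiE_dflt_def)

lemma prob_late_box:
  "measure_pmf.prob (anti_popularity_profile P) (late_box u x VZ) =
    (\<Prod>m\<in>UNIV. measure_pmf.prob (anti_popularity_list (P m)) {l. prefix (fst VZ m @ [u m]) (rev l)}) *
    (\<Prod>w\<in>UNIV. measure_pmf.prob (anti_popularity_list (\<lambda>m. P m w)) {l. prefix (snd VZ w @ [x w]) (rev l)})"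
  unfolding anti_popularity_profile_def late_box_def
  by (simp add: measure_pmf_prob_product measure_Pi_pmf_Pi countable_finite)

text \<open>The exchange of the next draw is carried out for every agent separately, with the late
  draws kept fixed.\<close>

lemma prob_late_box_swap:
  assumes "VZ \<in> late_draws u v x y"
  shows "measure_pmf.prob (anti_popularity_profile P) (late_box u x VZ) /
      ((\<Prod>m\<in>UNIV. P m (v m)) * (\<Prod>w\<in>UNIV. P (y w) w)) =
    measure_pmf.prob (anti_popularity_profile P) (late_box v y VZ) /
      ((\<Prod>m\<in>UNIV. P m (u m)) * (\<Prod>w\<in>UNIV. P (x w) w))"
proof -
  have men: "(\<Prod>m\<in>UNIV. measure_pmf.prob (anti_popularity_list (P m)) {l. prefix (fst VZ m @ [u m]) (rev l)} / P m (v m))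
    = (\<Prod>m\<in>UNIV. measure_pmf.prob (anti_popularity_list (P m)) {l. prefix (fst VZ m @ [v m]) (rev l)} / P m (u m))"
    using assms P_pos unfolding late_draws_def
    by (intro prod.cong refl prob_anti_popularity_list_swap) auto
  have women: "(\<Prod>w\<in>UNIV. measure_pmf.prob (anti_popularity_list (\<lambda>m. P m w)) {l. prefix (snd VZ w @ [x w]) (rev l)} / P (y w) w)
    = (\<Prod>w\<in>UNIV. measure_pmf.prob (anti_popularity_list (\<lambda>m. P m w)) {l. prefix (snd VZ w @ [y w]) (rev l)} / P (x w) w)"
    using assms P_pos unfolding late_draws_def
    by (intro prod.cong refl prob_anti_popularity_list_swap) auto
  show ?thesis
    unfolding prob_late_box times_divide_times_eq[symmetric] prod_dividef[symmetric] men women ..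
qed

lemma prob_swap_event:
  "measure_pmf.prob (anti_popularity_profile P) (swap_event u v x y) =
    (\<Sum>VZ\<in>late_draws u v x y. measure_pmf.prob (anti_popularity_profile P) (late_box u x VZ))"
proof -
  have "measure_pmf.prob (anti_popularity_profile P) (swap_event u v x y) =
    measure_pmf.prob (anti_popularity_profile P) (\<Union>VZ\<in>late_draws u v x y. late_box u x VZ)"
  \<comment> \<open>The two events are only compared on complete lists, that is, on the
    support.\<close>
  proof (rule measure_pmf.finite_measure_eq_AE)
    show "AE p in anti_popularity_profile P. p \<in> swap_event u v x y \<longleftrightarrow>
      p \<in> (\<Union>VZ\<in>late_draws u v x y. late_box u x VZ)"
    proof (rule AE_pmfI)
      fix p assume "p \<in> set_pmf (anti_popularity_profile P)"
      then show "p \<in> swap_event u v x y \<longleftrightarrow> p \<in> (\<Union>VZ\<in>late_draws u v x y. late_box u x VZ)"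
        using swap_event_iff_late_box[of "fst p" "snd p" u v x y] complete_profile[of "fst p" "snd p"]
        by simp
    qed
  qed simp_all
  also have "\<dots> = (\<Sum>VZ\<in>late_draws u v x y. measure_pmf.prob (anti_popularity_profile P) (late_box u x VZ))"
    by (rule measure_pmf.finite_measure_finite_Union[OF finite_late_draws _ disjoint_late_boxes]) simp
  finally show ?thesis .
qed

text \<open>Box by box, the two probabilities differ by the quotient of the two products in
  \<open>weights\<close>, which is 1.\<close>

lemma prob_swap_event_swap:
  assumes weights: "(\<Prod>m\<in>UNIV. P m (u m)) * (\<Prod>w\<in>UNIV. P (x w) w) =
    (\<Prod>m\<in>UNIV. P m (v m)) * (\<Prod>w\<in>UNIV. P (y w) w)"
  shows "measure_pmf.prob (anti_popularity_profile P) (swap_event u v x y) =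
    measure_pmf.prob (anti_popularity_profile P) (swap_event v u y x)"
  unfolding prob_swap_event late_draws_commute[of v u y x]
proof (rule sum.cong[OF refl])
  fix VZ assume "VZ \<in> late_draws u v x y"
  from prob_late_box_swap[OF this] show
    "measure_pmf.prob (anti_popularity_profile P) (late_box u x VZ) =
     measure_pmf.prob (anti_popularity_profile P) (late_box v y VZ)"
    unfolding weights using P_pos by (simp add: prod_zero_iff less_imp_neq[symmetric])
qed

end

section \<open>Outcome probabilities\<close>

text \<open>The nontrivial cycles of \<open>\<sigma>\<close> are required to be cycles of the
  pointing graph, as in the expansion of \<open>sum_cover_sign\<close>.\<close>

definition cover_event ::
    "('a \<Rightarrow> 'b list) \<Rightarrow> ('b \<Rightarrow> 'a list) \<Rightarrow> ('n \<Rightarrow> 'a) \<Rightarrow> ('n \<Rightarrow> 'b) \<Rightarrow> ('n \<Rightarrow> 'n) \<Rightarrow> bool" where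
  "cover_event pa pb \<alpha> \<beta> \<sigma> \<longleftrightarrow> stable_pairing pa pb \<alpha> \<beta> \<and>
     (\<forall>k. \<sigma> k \<noteq> k \<longrightarrow> next_suitor pa pb \<alpha> \<beta> k (\<sigma> k))"

context deferred_acceptance_market
begin

lemma of_bool_deferred_acceptance:
  fixes \<alpha> :: "'n::finite \<Rightarrow> 'a" and \<beta> :: "'n \<Rightarrow> 'b"
  assumes bij: "bij \<alpha>" "bij \<beta>"
  shows "of_bool (deferred_acceptance pa pb = range (\<lambda>k. (\<alpha> k, \<beta> k))) =
    (\<Sum>\<sigma> | \<sigma> permutes UNIV. cover_sign \<sigma> * of_bool (cover_event pa pb \<alpha> \<beta> \<sigma>))"
proof (cases "stable_pairing pa pb \<alpha> \<beta>")
  case True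
  have "l = l'" if "next_suitor pa pb \<alpha> \<beta> k l" "next_suitor pa pb \<alpha> \<beta> k l'" for k l l'
  proof -
    have "\<alpha> l = \<alpha> l'" using that prefers_total[OF complete_pb[of "\<beta> k"]] unfolding next_suitor_def by blast
    then show ?thesis using bij(1) by (simp add: bij_is_inj inj_eq)
  qed
  moreover have "\<not> next_suitor pa pb \<alpha> \<beta> k k" for k
    unfolding next_suitor_def would_follow_def using prefers_irrefl[OF complete_pb] by blast
  ultimately show ?thesis
    unfolding deferred_acceptance_eq_iff[OF bij] cover_event_def
    using True sum_cover_sign[of "next_suitor pa pb \<alpha> \<beta>"] by simp
qed (simp add: deferred_acceptance_eq_iff[OF bij] cover_event_def)

text \<open>Stability excludes willing proposers above \<open>\<alpha> k\<close> on the list of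
  \<open>\<beta> k\<close>, and the choice of the next suitor excludes those between
  \<open>\<alpha> k\<close> and \<open>\<alpha> (\<sigma> k)\<close>. Together this is the third
  condition; at a fixed point of \<open>\<sigma>\<close> it is stability alone.\<close>

lemma cover_event_iff:
  fixes \<alpha> :: "'n::finite \<Rightarrow> 'a" and \<beta> :: "'n \<Rightarrow> 'b"
  assumes bij: "bij \<alpha>" "bij \<beta>"
  shows "cover_event pa pb \<alpha> \<beta> \<sigma> \<longleftrightarrow>
    (\<forall>k. \<sigma> k \<noteq> k \<longrightarrow> prefers (pa (\<alpha> (\<sigma> k))) (\<beta> k) (\<beta> (\<sigma> k))) \<and>
    (\<forall>k. \<sigma> k \<noteq> k \<longrightarrow> prefers (pb (\<beta> k)) (\<alpha> k) (\<alpha> (\<sigma> k))) \<and>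
    (\<forall>k l. l \<noteq> k \<longrightarrow> l \<noteq> \<sigma> k \<longrightarrow>
       \<not> (prefers (pa (\<alpha> l)) (\<beta> k) (\<beta> l) \<and> prefers (pb (\<beta> k)) (\<alpha> l) (\<alpha> (\<sigma> k))))"
    (is "?L \<longleftrightarrow> ?R1 \<and> ?R2 \<and> ?R3")
proof (intro iffI conjI)
  assume L: ?L
  show ?R1 ?R2 using L unfolding cover_event_def next_suitor_def would_follow_def by blast+
  show ?R3
  proof (intro allI impI notI)
    fix k l assume l: "l \<noteq> k" "l \<noteq> \<sigma> k"
      "prefers (pa (\<alpha> l)) (\<beta> k) (\<beta> l) \<and> prefers (pb (\<beta> k)) (\<alpha> l) (\<alpha> (\<sigma> k))"
    show False
    proof (cases "\<sigma> k = k")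
      case True
      then show False using L l unfolding cover_event_def stable_pairing_def by metis
    next
      case False
      have "\<not> prefers (pb (\<beta> k)) (\<alpha> l) (\<alpha> k)"
        using L l(3) unfolding cover_event_def stable_pairing_def by blast
      moreover have "\<alpha> l \<noteq> \<alpha> k" using l(1) bij(1) by (simp add: bij_is_inj inj_eq)
      ultimately have "would_follow pa pb \<alpha> \<beta> k l"
        unfolding would_follow_def using l(3) prefers_total[OF complete_pb[of "\<beta> k"]] by blast
      then show False using L False l(3) unfolding cover_event_def next_suitor_def by blast
    qed
  qed
next
  assume R: "?R1 \<and> ?R2 \<and> ?R3"
  have better: "prefers (pb (\<beta> k)) a (\<alpha> (\<sigma> k))" if "prefers (pb (\<beta> k)) a (\<alpha> k)" for k a
    using that R prefers_trans[OF complete_pb[of "\<beta> k"]] by metis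
  have "stable_pairing pa pb \<alpha> \<beta>"
    unfolding stable_pairing_def
  proof (intro allI notI)
    fix k l assume l: "prefers (pa (\<alpha> l)) (\<beta> k) (\<beta> l) \<and> prefers (pb (\<beta> k)) (\<alpha> l) (\<alpha> k)"
    have "l \<noteq> k" using l prefers_irrefl[OF complete_pb] by metis
    moreover have "l \<noteq> \<sigma> k" using better[of k "\<alpha> l"] l prefers_irrefl[OF complete_pb] by metis
    ultimately show False using R l better by blast
  qed
  moreover have "next_suitor pa pb \<alpha> \<beta> k (\<sigma> k)" if "\<sigma> k \<noteq> k" for k
    unfolding next_suitor_def
  proof (intro conjI allI impI notI)
    show "would_follow pa pb \<alpha> \<beta> k (\<sigma> k)" using R that unfolding would_follow_def by simp
    fix l assume l: "would_follow pa pb \<alpha> \<beta> k l" "prefers (pb (\<beta> k)) (\<alpha> l) (\<alpha> (\<sigma> k))"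
    have "l \<noteq> k" using l(1) prefers_irrefl[OF complete_pb] unfolding would_follow_def by metis
    moreover have "l \<noteq> \<sigma> k" using l(2) prefers_irrefl[OF complete_pb] by metis
    ultimately show False using R l unfolding would_follow_def by blast
  qed
  ultimately show ?L unfolding cover_event_def by blast
qed

end

section \<open>Comparison of the two proposing sides\<close>

lemma prob_eq_signed_sum:
  assumes "\<And>p. p \<in> set_pmf D \<Longrightarrow> of_bool (Q p) = (\<Sum>i\<in>S. c i * of_bool (R i p) :: real)"
  shows "measure_pmf.prob D {p. Q p} = (\<Sum>i\<in>S. c i * measure_pmf.prob D {p. R i p})"
proof -
  have expectation: "measure_pmf.prob D {p. Q p} = measure_pmf.expectation D (\<lambda>p. of_bool (Q p))" for Q
  proof -
    have "(\<lambda>p. of_bool (Q p)) = indicat_real {p. Q p}" by (simp add: indicator_def fun_eq_iff)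
    then show ?thesis by simp
  qed
  have "measure_pmf.prob D {p. Q p} = measure_pmf.expectation D (\<lambda>p. \<Sum>i\<in>S. c i * of_bool (R i p))"
    unfolding expectation using assms by (intro integral_cong_AE AE_pmfI) auto
  also have "\<dots> = (\<Sum>i\<in>S. measure_pmf.expectation D (\<lambda>p. c i * of_bool (R i p)))"
    by (intro Bochner_Integration.integral_sum integrable_mult_right
        measure_pmf.integrable_const_bound[where B = 1]) auto
  finally show ?thesis by (simp add: expectation)
qed

lemma all_surj: "surj f \<Longrightarrow> (\<forall>x. Q x) \<longleftrightarrow> (\<forall>k. Q (f k))"
  by (metis surjD)

text \<open>Man \<open>m\<close> compares his partner \<open>\<mu> m\<close> with
  \<open>\<mu> (inv \<sigma> m)\<close>, the woman whose next suitor he is; woman \<open>w\<close>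
  compares her partner \<open>inv \<mu> w\<close> with her next suitor
  \<open>\<sigma> (inv \<mu> w)\<close>. At fixed points of \<open>\<sigma>\<close> the options
  coincide.\<close>

lemma cover_event_men_iff:
  fixes men :: "'m::finite \<Rightarrow> 'w::finite list"
  assumes "deferred_acceptance_market men women" and \<mu>: "bij \<mu>" and \<sigma>: "\<sigma> permutes UNIV"
  shows "cover_event men women id \<mu> \<sigma> \<longleftrightarrow>
    (men, women) \<in> swap_event \<mu> (\<mu> \<circ> inv \<sigma>) (\<sigma> \<circ> inv \<mu>) (inv \<mu>)"
proof -
  interpret deferred_acceptance_market men women by fact
  have inj: "\<mu> k = \<mu> l \<longleftrightarrow> k = l" "\<sigma> k = \<sigma> l \<longleftrightarrow> k = l" for k l
    using \<mu> permutes_inj[OF \<sigma>] by (simp_all add: bij_is_inj inj_eq)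
  have inv: "inv \<mu> (\<mu> k) = k" "inv \<sigma> (\<sigma> k) = k" for k
    using \<mu> permutes_inverses[OF \<sigma>] by (simp_all add: bij_is_inj)
  have invs: "l = inv \<sigma> k \<longleftrightarrow> \<sigma> l = k" for k l
    using permutes_inv_eq[OF \<sigma>] by metis
  have fixpoint: "k = \<sigma> k \<longleftrightarrow> \<sigma> k = k" for k by (rule eq_commute)
  show ?thesis
    unfolding cover_event_iff[OF bij_id \<mu>] swap_event_def mem_Collect_eq prod.case
      all_surj[OF bij_is_surj[OF \<mu>]] comp_apply inv id_apply
      all_surj[OF permutes_surj[OF \<sigma>], of "\<lambda>m. \<mu> (inv \<sigma> m) = \<mu> m \<or> prefers (men m) (\<mu> (inv \<sigma> m)) (\<mu> m)"]
    by (auto simp: inj invs fixpoint)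
qed

text \<open>With women proposing, the next suitor of man \<open>k\<close> is
  \<open>\<mu> (inv \<sigma> k)\<close>. Every agent compares the same two options as in
  \<open>cover_event_men_iff\<close>, with the opposite preference.\<close>

lemma cover_event_women_iff:
  fixes men :: "'m::finite \<Rightarrow> 'w::finite list"
  assumes "deferred_acceptance_market women men" and \<mu>: "bij \<mu>" and \<sigma>: "\<sigma> permutes UNIV"
  shows "cover_event women men \<mu> id (inv \<sigma>) \<longleftrightarrow>
    (men, women) \<in> swap_event (\<mu> \<circ> inv \<sigma>) \<mu> (inv \<mu>) (\<sigma> \<circ> inv \<mu>)"
proof -
  interpret deferred_acceptance_market women men by fact
  have inj: "\<mu> k = \<mu> l \<longleftrightarrow> k = l" "\<sigma> k = \<sigma> l \<longleftrightarrow> k = l" for k l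
    using \<mu> permutes_inj[OF \<sigma>] by (simp_all add: bij_is_inj inj_eq)
  have inv: "inv \<mu> (\<mu> k) = k" "inv \<sigma> (\<sigma> k) = k" for k
    using \<mu> permutes_inverses[OF \<sigma>] by (simp_all add: bij_is_inj)
  have invs: "l = inv \<sigma> k \<longleftrightarrow> \<sigma> l = k" "inv \<sigma> k = l \<longleftrightarrow> \<sigma> l = k" for k l
    using permutes_inv_eq[OF \<sigma>] by metis+
  have fixpoint: "k = \<sigma> k \<longleftrightarrow> \<sigma> k = k" for k by (rule eq_commute)
  show ?thesis
    unfolding cover_event_iff[OF \<mu> bij_id] swap_event_def mem_Collect_eq prod.case
      all_surj[OF bij_is_surj[OF \<mu>]] comp_apply inv id_apply
      all_surj[OF permutes_surj[OF \<sigma>], of "\<lambda>k. inv \<sigma> k \<noteq> k \<longrightarrow> prefers (women (\<mu> (inv \<sigma> k))) k (inv \<sigma> k)"]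
    by (auto simp: inj invs fixpoint)
qed

text \<open>For the graph \<open>E\<close> of a bijection, the signed sums agree term by term when
  \<open>\<sigma>\<close> is paired with \<open>inv \<sigma>\<close>; any other \<open>E\<close> has
  probability 0 on both sides.\<close>

theorem map_pmf_deferred_acceptance_eq:
  fixes P :: "'m::finite \<Rightarrow> 'w::finite \<Rightarrow> real"
  assumes card: "CARD('m) = CARD('w)" and P_pos: "\<And>m w. P m w > 0"
  shows "map_pmf (\<lambda>(men, women). deferred_acceptance men women) (anti_popularity_profile P) =
    map_pmf (\<lambda>(men, women). (deferred_acceptance women men)\<inverse>) (anti_popularity_profile P)"
proof (rule pmf_eqI)
  fix E :: "('m \<times> 'w) set"
  let ?D = "anti_popularity_profile P"
  let ?M = "\<lambda>p :: ('m \<Rightarrow> 'w list) \<times> ('w \<Rightarrow> 'm list). deferred_acceptance (fst p) (snd p)"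
  let ?W = "\<lambda>p :: ('m \<Rightarrow> 'w list) \<times> ('w \<Rightarrow> 'm list). deferred_acceptance (snd p) (fst p)"
  have market: "deferred_acceptance_market (fst p) (snd p)" "deferred_acceptance_market (snd p) (fst p)"
    if "p \<in> set_pmf ?D" for p
  proof -
    have "(fst p, snd p) \<in> set_pmf ?D" using that by simp
    note complete = complete_profile[OF P_pos this]
    show "deferred_acceptance_market (fst p) (snd p)"
      by (rule deferred_acceptance_market.intro) (rule complete card)+
    show "deferred_acceptance_market (snd p) (fst p)"
      by (rule deferred_acceptance_market.intro) (rule complete card[symmetric])+
  qed
  have "measure_pmf.prob ?D {p. ?M p = E} = measure_pmf.prob ?D {p. ?W p = E\<inverse>}"
  proof (cases "\<exists>\<mu>. bij \<mu> \<and> E = range (\<lambda>k. (k, \<mu> k))")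
    case True
    then obtain \<mu> where \<mu>: "bij \<mu>" "E = range (\<lambda>k. (id k, \<mu> k))" "E\<inverse> = range (\<lambda>k. (\<mu> k, id k))"
      by (auto simp: image_def converse_unfold)
    have "measure_pmf.prob ?D {p. ?M p = E} = (\<Sum>\<sigma> | \<sigma> permutes UNIV.
        cover_sign \<sigma> * measure_pmf.prob ?D {p. cover_event (fst p) (snd p) id \<mu> \<sigma>})"
      unfolding \<mu>(2)
      by (intro prob_eq_signed_sum deferred_acceptance_market.of_bool_deferred_acceptance market bij_id \<mu>(1))
    also have "\<dots> = (\<Sum>\<sigma> | \<sigma> permutes UNIV.
        cover_sign (inv \<sigma>) * measure_pmf.prob ?D {p. cover_event (snd p) (fst p) \<mu> id (inv \<sigma>)})"
    proof (intro sum.cong refl)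
      fix \<sigma> :: "'m \<Rightarrow> 'm" assume "\<sigma> \<in> {\<sigma>. \<sigma> permutes UNIV}"
      then have \<sigma>: "\<sigma> permutes UNIV" by simp
      have "measure_pmf.prob ?D {p. cover_event (fst p) (snd p) id \<mu> \<sigma>} =
          measure_pmf.prob ?D (swap_event \<mu> (\<mu> \<circ> inv \<sigma>) (\<sigma> \<circ> inv \<mu>) (inv \<mu>))"
        using cover_event_men_iff[OF market(1) \<mu>(1) \<sigma>]
        by (intro measure_pmf.finite_measure_eq_AE AE_pmfI) auto
      also have "\<dots> = measure_pmf.prob ?D (swap_event (\<mu> \<circ> inv \<sigma>) \<mu> (inv \<mu>) (\<sigma> \<circ> inv \<mu>))"
      proof (rule prob_swap_event_swap[OF P_pos])
        \<comment> \<open>With women indexed as \<open>\<mu> k\<close>, and men as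
          \<open>\<sigma> k\<close> in the product over \<open>\<mu> \<circ> inv \<sigma>\<close>,
          both sides are the product of all \<open>P k (\<mu> k)\<close> and all
          \<open>P (\<sigma> k) (\<mu> k)\<close>.\<close>
        have "(\<Prod>w\<in>UNIV. g w) = (\<Prod>k\<in>UNIV. g (\<mu> k))" for g :: "'w \<Rightarrow> real"
          using prod.reindex_bij_betw[OF \<mu>(1), of g] by simp
        moreover have "(\<Prod>m\<in>UNIV. g m) = (\<Prod>k\<in>UNIV. g (\<sigma> k))" for g :: "'m \<Rightarrow> real"
          using prod.reindex_bij_betw[OF permutes_bij[OF \<sigma>], of g] by simp
        note this[of "\<lambda>m. P m ((\<mu> \<circ> inv \<sigma>) m)"]
        ultimately show "(\<Prod>m\<in>UNIV. P m (\<mu> m)) * (\<Prod>w\<in>UNIV. P ((\<sigma> \<circ> inv \<mu>) w) w) =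
          (\<Prod>m\<in>UNIV. P m ((\<mu> \<circ> inv \<sigma>) m)) * (\<Prod>w\<in>UNIV. P (inv \<mu> w) w)"
          using \<mu>(1) by (simp add: bij_is_inj permutes_inverses[OF \<sigma>])
      qed
      also have "\<dots> = measure_pmf.prob ?D {p. cover_event (snd p) (fst p) \<mu> id (inv \<sigma>)}"
        using cover_event_women_iff[OF market(2) \<mu>(1) \<sigma>]
        by (intro measure_pmf.finite_measure_eq_AE AE_pmfI) auto
      finally show "cover_sign \<sigma> * measure_pmf.prob ?D {p. cover_event (fst p) (snd p) id \<mu> \<sigma>} =
        cover_sign (inv \<sigma>) * measure_pmf.prob ?D {p. cover_event (snd p) (fst p) \<mu> id (inv \<sigma>)}"
        by (simp add: cover_sign_inv[OF \<sigma>])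
    qed
    also have "\<dots> = (\<Sum>\<sigma> | \<sigma> permutes UNIV.
        cover_sign \<sigma> * measure_pmf.prob ?D {p. cover_event (snd p) (fst p) \<mu> id \<sigma>})"
      by (rule sum_permutations_inverse[symmetric])
    also have "\<dots> = measure_pmf.prob ?D {p. ?W p = E\<inverse>}"
      unfolding \<mu>(3)
      by (intro prob_eq_signed_sum[symmetric] deferred_acceptance_market.of_bool_deferred_acceptance
          market bij_id \<mu>(1))
    finally show ?thesis .
  next
    case False
    have no_M: "?M p \<noteq> E" if p: "p \<in> set_pmf ?D" for p
    proof
      assume E: "?M p = E"
      obtain f where "bij f" "?M p = {(a, b). f a = b}"
        by (rule deferred_acceptance_market.deferred_acceptance_bij[OF market(1)[OF p]])
      then show False using False E by auto
    qed
    have no_W: "?W p \<noteq> E\<inverse>" if p: "p \<in> set_pmf ?D" for p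
    proof
      assume E: "?W p = E\<inverse>"
      obtain f where f: "bij f" "?W p = {(a, b). f a = b}"
        by (rule deferred_acceptance_market.deferred_acceptance_bij[OF market(2)[OF p]])
      have "E = (E\<inverse>)\<inverse>" by simp
      also have "\<dots> = {(b, a). f a = b}" unfolding E[symmetric] f(2) by auto
      also have "\<dots> = range (\<lambda>k. (k, inv f k))"
        using f(1) by (auto simp: bij_is_inj bij_is_surj surj_f_inv_f)
      finally show False using False bij_imp_bij_inv[OF f(1)] by blast
    qed
    have "measure_pmf.prob ?D {p. ?M p = E} = 0"
      unfolding measure_pmf_zero_iff disjoint_iff mem_Collect_eq by (intro allI impI no_M)
    moreover have "measure_pmf.prob ?D {p. ?W p = E\<inverse>} = 0"
      unfolding measure_pmf_zero_iff disjoint_iff mem_Collect_eq by (intro allI impI no_W)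
    ultimately show ?thesis by (rule trans[OF _ sym])
  qed
  moreover have "X\<inverse> = E \<longleftrightarrow> X = E\<inverse>" for X by (metis converse_converse)
  then have "(\<lambda>(men, women). deferred_acceptance men women) -` {E} = {p. ?M p = E}"
    "(\<lambda>(men, women). (deferred_acceptance women men)\<inverse>) -` {E} = {p. ?W p = E\<inverse>}"
    by (simp_all add: vimage_def split_def)
  ultimately show "pmf (map_pmf (\<lambda>(men, women). deferred_acceptance men women) ?D) E =
    pmf (map_pmf (\<lambda>(men, women). (deferred_acceptance women men)\<inverse>) ?D) E"
    by (simp only: pmf_map)
qed

theorem theorem2:
  fixes P :: "'m::finite \<Rightarrow> 'w::finite \<Rightarrow> real" and N :: nat
  assumes "CARD('m) = N" and "CARD('w) = N"
    and "\<And>m w. P m w > 0"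
  shows "map_pmf MPDA (anti_popularity_profile P) = map_pmf WPDA (anti_popularity_profile P) \<and>
    (\<forall>\<mu> :: 'm + 'w \<Rightarrow> 'm + 'w. perfect_matching \<mu> \<longrightarrow>
       measure_pmf.prob (anti_popularity_profile P) {p. MPDA p = \<mu>} =
       measure_pmf.prob (anti_popularity_profile P) {p. WPDA p = \<mu>})"
proof -
  \<comment> \<open>Both outputs are the image under \<open>matching_of_pairs\<close> of a set of
    man-woman pairs, so equality of the laws of these sets suffices.\<close>
  have "map_pmf MPDA (anti_popularity_profile P) = map_pmf matching_of_pairs
      (map_pmf (\<lambda>(men, women). deferred_acceptance men women) (anti_popularity_profile P))"
    by (simp add: pmf.map_comp MPDA_def case_prod_unfold comp_def)
  also have "\<dots> = map_pmf matching_of_pairs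
      (map_pmf (\<lambda>(men, women). (deferred_acceptance women men)\<inverse>) (anti_popularity_profile P))"
    using assms by (subst map_pmf_deferred_acceptance_eq) simp_all
  also have "\<dots> = map_pmf WPDA (anti_popularity_profile P)"
    by (simp add: pmf.map_comp WPDA_def case_prod_unfold comp_def)
  finally have eq: "map_pmf MPDA (anti_popularity_profile P) = map_pmf WPDA (anti_popularity_profile P)" .
  have "measure_pmf.prob (anti_popularity_profile P) {p. MPDA p = \<mu>} =
      measure_pmf.prob (anti_popularity_profile P) {p. WPDA p = \<mu>}" for \<mu>
    using arg_cong[OF eq, of "\<lambda>D. pmf D \<mu>"] by (simp add: pmf_map vimage_def)
  with eq show ?thesis by simp
qed

end
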